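(* Let $S$ be a principal ideal semidomain. Then each non-zero (proper) $k$-prime ideal of $S$ is $k$-maximal.
   Context: A semiring is a commutative semiring $(S,+,0,\cdot,1)$ with multiplicative identity $1$ and additive identity $0$ that is absorbing. An ideal is a nonempty subset closed under addition and under multiplication by elements of $S$. A $k$-ideal is an ideal $I$ such that $x+y\in I$ and $y\in I$ imply $x\in I$. A semidomain is a semiring in which $ab=ac$ with $a\neq 0$ implies $b=c$. A principal ideal semidomain is a semidomain in which every ideal is principal. A $k$-ideal $I$ is $k$-prime if for all $k$-ideals $A,B$, $AB\subseteq I$ implies $A\subseteq I$ or $B\subseteq I$ ($AB$ is the ideal of finite sums of products $ab$, $a\in A$, $b\in B$). A $k$-ideal is $k$-maximal if it is proper and maximal among proper $k$-ideals. *)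

theory Defs
  imports Main
begin

text \<open>
  Unlike \<^class>\<open>comm_semiring_1\<close>, this class does not require \<open>0 \<noteq> 1\<close>,
  so the one-element semiring is included. Addition is not assumed to be cancellative.
\<close>

class comm_unital_semiring = comm_semiring_0 + comm_monoid_mult
begin

definition semiring_ideal :: "'a set \<Rightarrow> bool" where
  "semiring_ideal I \<longleftrightarrow>
     I \<noteq> {} \<and> (\<forall>x\<in>I. \<forall>y\<in>I. x + y \<in> I) \<and> (\<forall>s. \<forall>x\<in>I. s * x \<in> I)"

definition principal_ideal :: "'a set \<Rightarrow> bool" where
  "principal_ideal I \<longleftrightarrow> (\<exists>a. I = {s * a | s. True})"

definition k_ideal :: "'a set \<Rightarrow> bool" where
  "k_ideal I \<longleftrightarrow>
     semiring_ideal I \<and> (\<forall>x y. x + y \<in> I \<and> y \<in> I \<longrightarrow> x \<in> I)"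

definition ideal_mult :: "'a set \<Rightarrow> 'a set \<Rightarrow> 'a set" where
  "ideal_mult A B =
     {(\<Sum>i<n. a i * b i) | (n :: nat) a b. (\<forall>i<n. a i \<in> A \<and> b i \<in> B)}"

text \<open>Properness is not part of \<open>k_prime\<close>: the whole semiring satisfies this predicate.\<close>

definition k_prime :: "'a set \<Rightarrow> bool" where
  "k_prime I \<longleftrightarrow>
     k_ideal I \<and>
     (\<forall>A B. k_ideal A \<and> k_ideal B \<and> ideal_mult A B \<subseteq> I \<longrightarrow> A \<subseteq> I \<or> B \<subseteq> I)"

definition k_maximal :: "'a set \<Rightarrow> bool" where
  "k_maximal I \<longleftrightarrow>
     k_ideal I \<and> I \<noteq> UNIV \<and>
     (\<forall>J. k_ideal J \<and> J \<noteq> UNIV \<and> I \<subseteq> J \<longrightarrow> J = I)"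

end

class semidomain = comm_unital_semiring +
  assumes semidomain_cancel: "a * b = a * c \<Longrightarrow> a \<noteq> 0 \<Longrightarrow> b = c"

class principal_ideal_semidomain = semidomain +
  assumes ideal_is_principal: "semiring_ideal I \<Longrightarrow> principal_ideal I"

end

theory Submission
  imports Defs
begin

text \<open>
  Write \<open>P = (p)\<close> and let \<open>J = (j)\<close> be a \<open>k\<close>-ideal containing \<open>P\<close>, so that \<open>p = c j\<close>. The colon
  ideal \<open>(P : j)\<close> is a \<open>k\<close>-ideal with \<open>(P : j) J \<subseteq> P\<close>. As \<open>P\<close> is \<open>k\<close>-prime, either \<open>J \<subseteq> P\<close>, or
  \<open>c \<in> (P : j) \<subseteq> P\<close>; in the latter case \<open>c = d p\<close>, and cancelling \<open>p\<close> in \<open>p = d j p\<close>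
  shows that \<open>j\<close> is a unit.
\<close>

context comm_unital_semiring
begin

lemma semiring_ideal_zero:
  assumes "semiring_ideal I"
  shows "0 \<in> I"
proof -
  obtain x where "x \<in> I"
    using assms by (auto simp: semiring_ideal_def)
  then have "0 * x \<in> I"
    using assms unfolding semiring_ideal_def by blast
  then show ?thesis by simp
qed

lemma semiring_ideal_sum:
  fixes n :: nat
  assumes "semiring_ideal I" and "\<And>i. i < n \<Longrightarrow> f i \<in> I"
  shows "(\<Sum>i<n. f i) \<in> I"
  using assms(2)
proof (induction n)
  case 0
  then show ?case by (simp add: semiring_ideal_zero[OF assms(1)])
next
  case (Suc n)
  then show ?case
    using assms(1) by (simp add: semiring_ideal_def)
qed

text \<open>An ideal is closed under finite sums, so containment of the product ideal can be tested
  on single products.\<close>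

lemma ideal_mult_subset:
  assumes "semiring_ideal I" and "\<And>a b. a \<in> A \<Longrightarrow> b \<in> B \<Longrightarrow> a * b \<in> I"
  shows "ideal_mult A B \<subseteq> I"
  unfolding ideal_mult_def by (auto intro!: semiring_ideal_sum assms)

text \<open>The set is the preimage of \<open>I\<close> under multiplication by \<open>y\<close>,
  which is additive and commutes with scalars; hence both the ideal laws and the subtractive law
  pull back from \<open>I\<close>.\<close>

lemma k_ideal_colon:
  assumes "k_ideal I"
  shows "k_ideal {x. x * y \<in> I}"
proof -
  have I: "semiring_ideal I" and sub: "\<And>u v. u + v \<in> I \<Longrightarrow> v \<in> I \<Longrightarrow> u \<in> I"
    using assms unfolding k_ideal_def by blast+
  have "0 * y \<in> I"
    using semiring_ideal_zero[OF I] by simp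
  then have "{x. x * y \<in> I} \<noteq> {}"
    by blast
  with I have "semiring_ideal {x. x * y \<in> I}"
    unfolding semiring_ideal_def by (simp add: distrib_right mult.assoc)
  then show ?thesis
    unfolding k_ideal_def using sub by (auto simp: distrib_right)
qed

end

theorem theorem6p8:
  fixes P :: "'a :: principal_ideal_semidomain set"
  assumes "k_prime P" and "P \<noteq> {0}" and "P \<noteq> UNIV"
  shows "k_maximal P"
proof -
  have kP: "k_ideal P"
    and prime: "\<And>A B. k_ideal A \<Longrightarrow> k_ideal B \<Longrightarrow> ideal_mult A B \<subseteq> P \<Longrightarrow> A \<subseteq> P \<or> B \<subseteq> P"
    using assms(1) unfolding k_prime_def by blast+
  then have P: "semiring_ideal P"
    unfolding k_ideal_def by blast
  from ideal_is_principal[OF P] obtain p where p: "P = {s * p | s. True}"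
    unfolding principal_ideal_def by blast
  \<comment> \<open>The generator \<open>0\<close> would give \<open>P = {0}\<close>. Cancelling
    \<open>p\<close> below relies on this.\<close>
  have "p \<noteq> 0"
    using p assms(2) by auto
  have "J = P" if kJ: "k_ideal J" and "J \<noteq> UNIV" and "P \<subseteq> J" for J
  proof -
    have "semiring_ideal J"
      using kJ unfolding k_ideal_def by blast
    from ideal_is_principal[OF this] obtain j where j: "J = {s * j | s. True}"
      unfolding principal_ideal_def by blast
    have "p \<in> P"
      unfolding p by (auto intro: exI[of _ 1])
    with \<open>P \<subseteq> J\<close> obtain c where c: "p = c * j"
      unfolding j by blast
    \<comment> \<open>The colon condition tests only the generator \<open>j\<close>; for a general
      \<open>b = s * j\<close>, the product \<open>a * b\<close> is the multiple
      \<open>s * (a * j)\<close> of an element of \<open>P\<close>.\<close>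
    have "ideal_mult {x. x * j \<in> P} J \<subseteq> P"
    proof (rule ideal_mult_subset[OF P])
      fix a b assume "a \<in> {x. x * j \<in> P}" "b \<in> J"
      then obtain s where "a * j \<in> P" "b = s * j"
        unfolding j by blast
      then have "s * (a * j) \<in> P"
        using P unfolding semiring_ideal_def by blast
      then show "a * b \<in> P"
        using \<open>b = s * j\<close> by (simp add: ac_simps)
    qed
    then consider "{x. x * j \<in> P} \<subseteq> P" | "J \<subseteq> P"
      using prime[OF k_ideal_colon[OF kP] kJ] by blast
    then show "J = P"
    proof cases
      case 1
      have "c \<in> P"
        using 1 \<open>p \<in> P\<close> c by auto
      then obtain d where "c = d * p"
        unfolding p by blast
      with c have "p = (d * p) * j"
        by simp
      \<comment> \<open>The factor \<open>1\<close> puts the equation into the shape that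
        \<open>semidomain_cancel\<close> expects.\<close>
      then have "p * (d * j) = p * 1"
        by (simp add: ac_simps)
      then have "d * j = 1"
        using semidomain_cancel \<open>p \<noteq> 0\<close> by blast
      then have "x = (x * d) * j" for x
        by (simp add: mult.assoc)
      then have "J = UNIV"
        unfolding j by blast
      with \<open>J \<noteq> UNIV\<close> show ?thesis by contradiction
    next
      case 2
      with \<open>P \<subseteq> J\<close> show ?thesis by blast
    qed
  qed
  then show ?thesis
    unfolding k_maximal_def using kP assms(3) by blast
qed

end
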